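(* Let $\sum_{n\ge 1} a_n$ be a fast convergent series, with remainders $r_n=\sum_{j>n}a_j$ and set of subsums $E$. If $$\max_{k\ge n+2}(a_k-r_k)\ <\ a_n-r_n\qquad\text{for all } n\in\mathbb N,$$ then $$C(E)=\{0\}\cup\{a_n:\ n\in\mathbb N\}.$$
   Context: Throughout, a series $\sum a_n$ is a convergent series $\sum_{n=1}^\infty a_n$ with positive and nonincreasing terms, and $\mathbb N=\{1,2,\dots\}$. Its $k$-th remainder is $r_k:=\sum_{n>k}a_n$. The series is fast convergent if $a_n>r_n$ for all $n\in\mathbb N$. Its set of subsums is $E:=\{x\in\mathbb R:\ \exists A\subset\mathbb N,\ x=\sum_{n\in A}a_n\}$ (the empty sum is $0$). For a nonempty subset $A$ of a metric space $(X,d)$, the center of distances of $A$ is $C(A):=\{\alpha\in[0,+\infty):\ \forall x\in A\ \exists y\in A\ d(x,y)=\alpha\}$; subsets of $\mathbb R$ carry the usual metric. *)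

theory Defs
  imports "HOL-Analysis.Analysis"
begin

(* Series are indexed by {1, 2, ...}; the value a 0 is never used. *)

definition admissible_series :: "(nat \<Rightarrow> real) \<Rightarrow> bool" where
  "admissible_series a \<longleftrightarrow>
     summable (\<lambda>n. a (Suc n)) \<and> (\<forall>n\<ge>1. 0 < a n) \<and> antimono_on {1..} a"

definition remainder :: "(nat \<Rightarrow> real) \<Rightarrow> nat \<Rightarrow> real" where
  "remainder a k = (\<Sum>j. a (k + Suc j))"

definition fast_convergent :: "(nat \<Rightarrow> real) \<Rightarrow> bool" where
  "fast_convergent a \<longleftrightarrow> admissible_series a \<and> (\<forall>n\<ge>1. remainder a n < a n)"

(* The terms are positive, so every subsum converges unconditionally. *)
definition subsums :: "(nat \<Rightarrow> real) \<Rightarrow> real set" where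
  "subsums a = {x. \<exists>A\<subseteq>{1..}. x = (\<Sum>\<^sub>\<infinity>n\<in>A. a n)}"

definition center_of_distances :: "'a::metric_space set \<Rightarrow> real set" where
  "center_of_distances A = {\<alpha>. 0 \<le> \<alpha> \<and> (\<forall>x\<in>A. \<exists>y\<in>A. dist x y = \<alpha>)}"

(* The maximum of a k - remainder a k over the infinite set of all k \<ge> m.
   GREATEST is only meaningful if the maximum is attained; the lemma below shows that
   it is for fast convergent series. *)
definition max_gap_from :: "(nat \<Rightarrow> real) \<Rightarrow> nat \<Rightarrow> real" where
  "max_gap_from a m = (GREATEST x. x \<in> (\<lambda>k. a k - remainder a k) ` {m..})"

lemma max_gap_from_attained:
  assumes "fast_convergent a" and "m \<ge> 1"
  shows "max_gap_from a m \<in> (\<lambda>k. a k - remainder a k) ` {m..}"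
    and "\<And>k. k \<ge> m \<Longrightarrow> a k - remainder a k \<le> max_gap_from a m"
proof -
  define f where "f = (\<lambda>k. a k - remainder a k)"
  have fpos: "f k > 0" if "k \<ge> 1" for k
    using assms(1) that by (auto simp: fast_convergent_def admissible_series_def f_def)
  have sm: "summable (\<lambda>n. a (Suc n))"
    using assms(1) by (auto simp: fast_convergent_def admissible_series_def)
  have a0: "a \<longlonglongrightarrow> 0"
    using summable_LIMSEQ_zero[OF sm] by (simp add: filterlim_sequentially_Suc)
  have "(\<lambda>k. remainder a k) = (\<lambda>k. \<Sum>j. a (Suc (j + k)))"
    by (simp add: remainder_def add.commute)
  then have r0: "remainder a \<longlonglongrightarrow> 0"
    using suminf_exist_split2[OF sm] by simp
  have "f \<longlonglongrightarrow> 0"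
    unfolding f_def using tendsto_diff[OF a0 r0] by simp
  then have "eventually (\<lambda>k. f k < f m) sequentially"
    using fpos[OF assms(2)] by (rule order_tendstoD(2))
  then obtain N where N: "\<And>k. k \<ge> N \<Longrightarrow> f k < f m"
    by (auto simp: eventually_sequentially)
  let ?M = "Max (f ` {m..m + N})"
  have "?M \<in> f ` {m..m + N}"
    by (rule Max_in) auto
  moreover have "f ` {m..m + N} \<subseteq> f ` {m..}"
    by (rule image_mono) auto
  ultimately have mem: "?M \<in> f ` {m..}" by blast
  have ub: "f k \<le> ?M" if "k \<ge> m" for k
  proof (cases "k \<le> m + N")
    case True
    then show ?thesis using that by (intro Max_ge) auto
  next
    case False
    then have "f k \<le> f m" using N[of k] by simp
    also have "f m \<le> ?M" by (intro Max_ge) auto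
    finally show ?thesis .
  qed
  have "max_gap_from a m = ?M"
    unfolding max_gap_from_def f_def[symmetric]
    by (rule Greatest_equality) (use mem ub in auto)
  then show "max_gap_from a m \<in> (\<lambda>k. a k - remainder a k) ` {m..}"
    and "\<And>k. k \<ge> m \<Longrightarrow> a k - remainder a k \<le> max_gap_from a m"
    using mem ub by (simp_all add: f_def)
qed

end

theory Submission
  imports Defs
begin

text \<open>
  Toggling the membership of \<open>n\<close> in an index set moves its subsum by exactly \<open>a n\<close>, so every
  term is a common distance. The content of the theorem is that no other positive number is.

  Since \<open>0\<close> is a subsum, a common distance \<open>\<alpha>\<close> is itself a subsum, over some set \<open>A\<close>. Let \<open>A\<close>
  have at least two elements, let \<open>p\<close> be the least one, and write \<open>\<alpha> = a p + \<beta>\<close>, where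
  \<open>\<beta> > 0\<close> is a subsum of the tail after \<open>p\<close>. The aim is a subsum \<open>x\<close> such that neither \<open>x - \<alpha>\<close> nor
  \<open>x + \<alpha>\<close> is a subsum. Any \<open>x\<close> from the tail after \<open>p\<close> makes \<open>x - \<alpha>\<close> negative, because
  \<open>x \<le> remainder a p < a p \<le> \<alpha>\<close>. To control \<open>x + \<alpha>\<close>, take \<open>x = remainder a p - y\<close> with a
  subsum \<open>y\<close> of the same tail lying slightly below \<open>\<beta>\<close>; this gives
  \<open>x + \<alpha> = remainder a (p - 1) + (\<beta> - y)\<close>. No subsum lies strictly between
  \<open>remainder a (p - 1)\<close> and \<open>a (p - 1)\<close> (\<open>no_subsum_in_gap\<close>), so it remains to have
  \<open>0 < \<beta> - y < a (p - 1) - remainder a (p - 1)\<close>. When \<open>p = 1\<close>, the number \<open>x + \<alpha>\<close>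
  exceeds the sum of the whole series.

  Such a \<open>y\<close> exists (\<open>subsum_slightly_below\<close>) because \<open>\<beta>\<close> is either a limit from the left of
  subsums of the tail, or the right endpoint of a gap of length \<open>a k - remainder a k\<close> for some
  \<open>k \<ge> p + 1\<close>. For \<open>p \<ge> 2\<close>, the hypothesis of the theorem at \<open>n = p - 1\<close> says precisely that
  these gaps are shorter than the gap ending at \<open>a (p - 1)\<close>.
\<close>

section \<open>Subsums of a positive series\<close>

lemma admissible_summable_on:
  assumes "admissible_series a" and "A \<subseteq> {1..}"
  shows "a summable_on A"
proof -
  have "summable (\<lambda>n. a (Suc n))" and pos: "\<And>n. a (Suc n) > 0"
    using assms(1) by (auto simp: admissible_series_def)
  then have "(\<lambda>n. a (Suc n)) summable_on UNIV"
    by (subst summable_on_UNIV_nonneg_real_iff) (auto intro: less_imp_le)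
  then have "a summable_on range Suc"
    by (subst summable_on_reindex) (auto simp: o_def)
  moreover have "range Suc = {1..}"
    using greaterThan_0 by auto
  ultimately show ?thesis
    using assms(2) by (metis summable_on_subset_banach)
qed

lemma remainder_eq_infsum:
  assumes "admissible_series a"
  shows "remainder a k = infsum a {k<..}"
proof -
  have im: "range (\<lambda>j. k + Suc j) = {k<..}"
    by (auto simp: image_iff) (metis less_iff_Suc_add)
  have inj: "inj (\<lambda>j. k + Suc j)"
    by (auto intro: injI)
  have "a summable_on {k<..}"
    using assms by (rule admissible_summable_on) auto
  then have "(\<lambda>j. a (k + Suc j)) summable_on UNIV"
    using inj im by (metis summable_on_reindex [unfolded o_def])
  then have "((\<lambda>j. a (k + Suc j)) has_sum (\<Sum>\<^sub>\<infinity>j. a (k + Suc j))) UNIV"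
    by (rule has_sum_infsum)
  then have "remainder a k = (\<Sum>\<^sub>\<infinity>j. a (k + Suc j))"
    unfolding remainder_def by (metis has_sum_imp_sums sums_unique)
  also have "\<dots> = infsum a {k<..}"
    using infsum_reindex[OF inj, of a] unfolding im o_def by simp
  finally show ?thesis .
qed

lemma infsum_in_subsums:
  assumes "A \<subseteq> {1..}"
  shows "infsum a A \<in> subsums a"
  using assms unfolding subsums_def by blast

lemma subsum_insert:
  assumes "admissible_series a" and "A \<subseteq> {1..}" and "n \<ge> 1" and "n \<notin> A"
  shows "infsum a (insert n A) = a n + infsum a A"
  using infsum_insert[OF admissible_summable_on[OF assms(1,2)] assms(4)] .

lemma subsum_remove:
  assumes "admissible_series a" and "A \<subseteq> {1..}" and "n \<in> A"
  shows "infsum a A = a n + infsum a (A - {n})"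
proof -
  have "infsum a (insert n (A - {n})) = a n + infsum a (A - {n})"
    by (rule subsum_insert[OF assms(1)]) (use assms(2,3) in auto)
  then show ?thesis
    by (simp only: insert_Diff[OF assms(3)])
qed

lemma subsum_mono:
  assumes "admissible_series a" and "A \<subseteq> B" and "B \<subseteq> {1..}"
  shows "infsum a A \<le> infsum a B"
proof (rule infsum_mono_neutral)
  show "a summable_on A" "a summable_on B"
    using assms by (auto intro!: admissible_summable_on)
  have "0 \<le> a n" if "n \<in> B" for n
    using assms(1,3) that by (auto simp: admissible_series_def intro: less_imp_le)
  then show "\<And>n. n \<in> B - A \<Longrightarrow> 0 \<le> a n"
    by blast
qed (use assms(2) in auto)

lemma subsum_nonneg:
  assumes "admissible_series a" and "A \<subseteq> {1..}"
  shows "0 \<le> infsum a A"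
  using subsum_mono[OF assms(1) empty_subsetI assms(2)] by simp

lemma subsum_ge_term:
  assumes "admissible_series a" and "A \<subseteq> {1..}" and "n \<in> A"
  shows "a n \<le> infsum a A"
proof -
  have "0 \<le> infsum a (A - {n})"
    by (rule subsum_nonneg[OF assms(1)]) (use assms(2) in blast)
  then show ?thesis
    using subsum_remove[OF assms] by simp
qed

lemma remainder_step:
  assumes "admissible_series a" and "p \<ge> 1"
  shows "remainder a (p - 1) = a p + remainder a p"
proof -
  have "{p - 1<..} = insert p {p<..}"
    using assms(2) by auto
  moreover have "infsum a (insert p {p<..}) = a p + infsum a {p<..}"
    by (rule subsum_insert[OF assms(1)]) (use assms(2) in auto)
  ultimately show ?thesis
    by (simp only: remainder_eq_infsum[OF assms(1)])
qed

lemma remainder_minus_subsum: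
  assumes "admissible_series a" and "B \<subseteq> {p<..}"
  shows "remainder a p - infsum a B = infsum a ({p<..} - B)"
proof -
  have "infsum a (B \<union> ({p<..} - B)) = infsum a B + infsum a ({p<..} - B)"
    by (rule infsum_Un_disjoint) (use assms in \<open>auto intro!: admissible_summable_on\<close>)
  moreover have "B \<union> ({p<..} - B) = {p<..}"
    using assms(2) by blast
  ultimately show ?thesis
    by (simp add: remainder_eq_infsum[OF assms(1)])
qed

section \<open>Gaps between subsums\<close>

text \<open>
  An index set meeting \<open>{1..q}\<close> has a subsum of at least \<open>a q\<close>, as the terms do not increase;
  any other index set consists of indices after \<open>q\<close>.
\<close>

lemma no_subsum_in_gap:
  assumes "admissible_series a" and "B \<subseteq> {1..}"
    and "remainder a q < infsum a B"
  shows "q \<ge> 1" and "a q \<le> infsum a B"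
proof -
  have "\<not> B \<subseteq> {q<..}"
  proof
    assume "B \<subseteq> {q<..}"
    then have "infsum a B \<le> remainder a q"
      unfolding remainder_eq_infsum[OF assms(1)] by (rule subsum_mono[OF assms(1)]) auto
    then show False
      using assms(3) by simp
  qed
  then obtain n where n: "n \<in> B" "n \<le> q"
    by (meson greaterThan_iff not_less subsetI)
  then have "n \<ge> 1"
    using assms(2) by auto
  then show "q \<ge> 1"
    using n by simp
  have "a q \<le> a n"
    using assms(1) n \<open>n \<ge> 1\<close> by (auto simp: admissible_series_def monotone_on_def)
  also have "\<dots> \<le> infsum a B"
    using subsum_ge_term[OF assms(1,2)] n by blast
  finally show "a q \<le> infsum a B" .
qed

text \<open>
  If \<open>B\<close> is infinite, dropping one far-away index lowers its subsum by an arbitrarily small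
  amount. If \<open>B\<close> is finite with greatest element \<open>k\<close>, replacing \<open>k\<close> by all later indices lowers the
  subsum by \<open>a k - remainder a k\<close>, which is positive by fast convergence.
\<close>

lemma subsum_slightly_below:
  assumes "fast_convergent a" and "B \<subseteq> {p<..}" and "B \<noteq> {}" and "0 < d"
    and gaps: "\<And>k. k > p \<Longrightarrow> a k - remainder a k < d"
  obtains C where "C \<subseteq> {p<..}" and "infsum a C < infsum a B" and "infsum a B - infsum a C < d"
proof (cases "finite B")
  case False
  have adm: "admissible_series a"
    using assms(1) by (simp add: fast_convergent_def)
  have "(\<lambda>n. a (Suc n)) \<longlonglongrightarrow> 0"
    using adm by (intro summable_LIMSEQ_zero) (simp add: admissible_series_def)
  then have "a \<longlonglongrightarrow> 0"
    by (simp add: filterlim_sequentially_Suc)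
  then have "eventually (\<lambda>k. a k < d) sequentially"
    using \<open>0 < d\<close> by (rule order_tendstoD(2))
  then obtain N where N: "\<And>k. k \<ge> N \<Longrightarrow> a k < d"
    by (auto simp: eventually_sequentially)
  obtain k where k: "k \<in> B" "k \<ge> N"
    using False by (metis infinite_nat_iff_unbounded_le)
  have "infsum a B = a k + infsum a (B - {k})"
    by (rule subsum_remove[OF adm]) (use assms(2) k in auto)
  moreover have "a k > 0"
    using adm assms(2) k by (force simp: admissible_series_def)
  ultimately show ?thesis
    using that[of "B - {k}"] assms(2) N[OF k(2)] by auto
next
  case True
  have adm: "admissible_series a"
    using assms(1) by (simp add: fast_convergent_def)
  define k where "k = Max B"
  have k: "k \<in> B" "\<And>j. j \<in> B \<Longrightarrow> j \<le> k"
    using True \<open>B \<noteq> {}\<close> by (auto simp: k_def)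
  then have "k > p"
    using assms(2) by auto
  have "infsum a B = a k + infsum a (B - {k})"
    by (rule subsum_remove[OF adm]) (use assms(2) k in auto)
  moreover have "infsum a ((B - {k}) \<union> {k<..}) = infsum a (B - {k}) + infsum a {k<..}"
  proof (rule infsum_Un_disjoint)
    show "a summable_on B - {k}" "a summable_on {k<..}"
      using adm assms(2) by (auto intro!: admissible_summable_on)
    show "(B - {k}) \<inter> {k<..} = {}"
      using k(2) by force
  qed
  moreover have "remainder a k < a k"
    using assms(1) \<open>k > p\<close> by (auto simp: fast_convergent_def)
  moreover have "(B - {k}) \<union> {k<..} \<subseteq> {p<..}"
    using assms(2) \<open>k > p\<close> by auto
  ultimately show ?thesis
    using that[of "(B - {k}) \<union> {k<..}"] gaps[OF \<open>k > p\<close>]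
    by (simp add: remainder_eq_infsum[OF adm])
qed

section \<open>The center of distances\<close>

lemma zero_in_center_of_distances: "0 \<in> center_of_distances X"
  by (auto simp: center_of_distances_def)

lemma term_in_center_of_distances:
  assumes "admissible_series a" and "n \<ge> 1"
  shows "a n \<in> center_of_distances (subsums a)"
  unfolding center_of_distances_def
proof (intro CollectI conjI ballI)
  have pos: "a n > 0"
    using assms by (auto simp: admissible_series_def)
  then show "0 \<le> a n"
    by simp
  fix x assume "x \<in> subsums a"
  then obtain A where A: "A \<subseteq> {1..}" and x: "x = infsum a A"
    by (auto simp: subsums_def)
  show "\<exists>y\<in>subsums a. dist x y = a n"
  proof (cases "n \<in> A")
    case True
    have "infsum a (A - {n}) \<in> subsums a"
      by (rule infsum_in_subsums) (use A in blast)
    moreover have "dist x (infsum a (A - {n})) = a n"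
      using subsum_remove[OF assms(1) A True] pos x by (simp add: dist_real_def)
    ultimately show ?thesis by blast
  next
    case False
    have "infsum a (insert n A) \<in> subsums a"
      by (rule infsum_in_subsums) (use A assms(2) in auto)
    moreover have "dist x (infsum a (insert n A)) = a n"
      using subsum_insert[OF assms(1) A assms(2) False] pos x by (simp add: dist_real_def)
    ultimately show ?thesis by blast
  qed
qed

text \<open>
  The witness is the sum \<open>x\<close> of the tail after \<open>p\<close> minus a subsum slightly below \<open>infsum a B\<close>. Being
  less than \<open>a p\<close>, it has no subsum at the given distance to its left; to its right, that distance
  leads just beyond \<open>remainder a (p - 1)\<close>, into the gap before \<open>a (p - 1)\<close> or, for \<open>p = 1\<close>, beyond
  every subsum.
\<close>

lemma compound_subsum_not_in_center_of_distances:
  assumes fast: "fast_convergent a" and p: "p \<ge> 1"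
    and B: "B \<subseteq> {p<..}" "B \<noteq> {}"
    and gaps: "\<And>k. p \<ge> 2 \<Longrightarrow> k > p \<Longrightarrow>
      a k - remainder a k < a (p - 1) - remainder a (p - 1)"
  shows "a p + infsum a B \<notin> center_of_distances (subsums a)"
proof
  assume center: "a p + infsum a B \<in> center_of_distances (subsums a)"
  have adm: "admissible_series a" and rem: "\<And>n. n \<ge> 1 \<Longrightarrow> remainder a n < a n"
    using fast by (auto simp: fast_convergent_def)
  \<comment> \<open>For \<open>p = 1\<close> any bound exceeding all gaps after \<open>p\<close> will do, and each such gap is at most \<open>a p\<close>.\<close>
  define d where "d = (if p \<ge> 2 then a (p - 1) - remainder a (p - 1) else a p + 1)"
  have "0 < d"
    using adm p rem[of "p - 1"] by (force simp: d_def admissible_series_def)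
  moreover have "a k - remainder a k < d" if "k > p" for k
  proof -
    have "a k \<le> a p"
      using adm p that by (auto simp: admissible_series_def monotone_on_def)
    moreover have "0 \<le> remainder a k"
      unfolding remainder_eq_infsum[OF adm] by (rule subsum_nonneg[OF adm]) auto
    ultimately show ?thesis
      using gaps[OF _ that] by (auto simp: d_def)
  qed
  ultimately obtain C where C: "C \<subseteq> {p<..}" "infsum a C < infsum a B"
      "infsum a B - infsum a C < d"
    using subsum_slightly_below[OF fast B] by metis
  define x where "x = remainder a p - infsum a C"
  have "x \<in> subsums a"
    unfolding x_def remainder_minus_subsum[OF adm C(1)] by (rule infsum_in_subsums) auto
  then obtain y where "y \<in> subsums a" and y: "dist x y = a p + infsum a B"
    using center by (auto simp: center_of_distances_def)
  then obtain D where D: "D \<subseteq> {1..}" "y = infsum a D"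
    by (auto simp: subsums_def)
  have tail: "{p<..} \<subseteq> {1..}"
    by auto
  have nonneg: "0 \<le> y" "0 \<le> infsum a B" "0 \<le> infsum a C"
    unfolding D(2) using D(1) order_trans[OF B(1) tail] order_trans[OF C(1) tail]
    by (blast intro: subsum_nonneg[OF adm])+
  have "x < a p"
    using rem[OF p] nonneg by (simp add: x_def)
  then have "y = x + (a p + infsum a B)"
    using y nonneg by (simp add: dist_real_def)
  then have y_eq: "y = remainder a (p - 1) + (infsum a B - infsum a C)"
    using remainder_step[OF adm p] by (simp add: x_def)
  then have above: "remainder a (p - 1) < infsum a D"
    using C(2) D(2) by simp
  have "p \<ge> 2" and "a (p - 1) \<le> y"
    using no_subsum_in_gap[OF adm D(1) above] D(2) by auto
  then show False
    using y_eq C(3) by (simp add: d_def)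
qed

theorem theorem3p4:
  fixes a :: "nat \<Rightarrow> real"
  assumes "fast_convergent a"
    and "\<And>n. n \<ge> 1 \<Longrightarrow> max_gap_from a (n + 2) < a n - remainder a n"
  shows "center_of_distances (subsums a) = {0} \<union> {a n | n. n \<ge> 1}"
proof
  have adm: "admissible_series a"
    using assms(1) by (simp add: fast_convergent_def)
  then show "{0} \<union> {a n | n. n \<ge> 1} \<subseteq> center_of_distances (subsums a)"
    using zero_in_center_of_distances term_in_center_of_distances by blast
  show "center_of_distances (subsums a) \<subseteq> {0} \<union> {a n | n. n \<ge> 1}"
  proof
    fix \<alpha> assume \<alpha>: "\<alpha> \<in> center_of_distances (subsums a)"
    \<comment> \<open>The points of \<open>subsums a\<close> at distance \<open>\<alpha>\<close> from the subsum \<open>0\<close> can only be \<open>\<alpha>\<close> itself.\<close>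
    have "0 \<in> subsums a"
      using infsum_in_subsums[of "{}" a] by simp
    then obtain y where "y \<in> subsums a" "dist 0 y = \<alpha>"
      using \<alpha> by (auto simp: center_of_distances_def)
    then obtain A where A: "A \<subseteq> {1..}" and \<alpha>_eq: "\<alpha> = infsum a A"
      using subsum_nonneg[OF adm] by (auto simp: subsums_def dist_real_def)
    show "\<alpha> \<in> {0} \<union> {a n | n. n \<ge> 1}"
    proof (cases "A = {}")
      case True
      then show ?thesis by (simp add: \<alpha>_eq)
    next
      case False
      define p where "p = (LEAST n. n \<in> A)"
      have p: "p \<in> A" "\<And>n. n \<in> A \<Longrightarrow> p \<le> n"
        using False by (auto simp: p_def intro: LeastI Least_le)
      then have "p \<ge> 1"
        using A by auto
      have split: "\<alpha> = a p + infsum a (A - {p})"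
        using subsum_remove[OF adm A p(1)] \<alpha>_eq by simp
      have "a k - remainder a k < a (p - 1) - remainder a (p - 1)" if "p \<ge> 2" "k > p" for k
      proof -
        have "a k - remainder a k \<le> max_gap_from a (p - 1 + 2)"
          by (rule max_gap_from_attained(2)[OF assms(1)]) (use that in auto)
        also have "\<dots> < a (p - 1) - remainder a (p - 1)"
          by (rule assms(2)) (use that in simp)
        finally show ?thesis .
      qed
      moreover have "A - {p} \<subseteq> {p<..}"
        using p(2) by force
      ultimately have "A - {p} = {}"
        using compound_subsum_not_in_center_of_distances[OF assms(1) \<open>p \<ge> 1\<close>, of "A - {p}"]
          \<alpha> split by blast
      then have "\<alpha> = a p"
        using split by (simp only: infsum_empty add_0_right)
      then show ?thesis
        using \<open>p \<ge> 1\<close> by blast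
    qed
  qed
qed

end
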